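(* Let $K,N\ge 1$, $NK<m$, let $\mathbf{\Phi}\in\mathbb{R}^{m\times n}$, let $\mathbf{x}\in\mathbb{R}^n$ be $K$-sparse, and let $\mathbf{y}=\mathbf{\Phi}\mathbf{x}$. If $\mathbf{\Phi}$ satisfies the restricted isometry property (RIP) of order $NK+1$ with RIP constant $$\delta_{NK+1}<\frac{\sqrt{N}}{\sqrt{K}+\sqrt{N}},$$ then the generalized orthogonal matching pursuit algorithm (gOMP), selecting $N$ atoms per iteration and applied to input $(\mathbf{y},\mathbf{\Phi})$, recovers $\mathbf{x}$ exactly by its $K$-th iteration.
   Context: A vector is $K$-sparse if it has at most $K$ nonzero entries. For an index set $I\subseteq\{1,\dots,n\}$, $\mathbf{\Phi}_I$ is the submatrix of $\mathbf{\Phi}$ with columns indexed by $I$; $\phi_j$ is the $j$-th column of $\mathbf{\Phi}$. RIP: $\mathbf{\Phi}\in\mathbb{R}^{m\times n}$ satisfies RIP of order $L$ if there is $\delta\in(0,1)$ such that for all $I\subseteq\{1,\dots,n\}$ with $|I|\le L$ and all $\mathbf{q}\in\mathbb{R}^{I}$, $(1-\delta)\|\mathbf{q}\|_2^2\le\|\mathbf{\Phi}_I\mathbf{q}\|_2^2\le(1+\delta)\|\mathbf{q}\|_2^2$. The RIP constant $\delta_L$ is the smallest $\delta$ for which these inequalities hold. gOMP algorithm (input $\mathbf{y}\in\mathbb{R}^m$, $\mathbf{\Phi}\in\mathbb{R}^{m\times n}$, parameters $K,N$ with $NK<m$): set $k=0$, $\mathbf{r}^0=\mathbf{y}$, $\Lambda^0=\emptyset$.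 While $k<K$ and $\|\mathbf{r}^k\|_2<\|\mathbf{r}^{k-1}\|_2$ (the second condition being vacuous for $k=0$): replace $k$ by $k+1$; let $h^k$ be a set of $N$ indices $j\in\{1,\dots,n\}$ for which $|\langle \mathbf{r}^{k-1},\phi_j\rangle|$ is largest; put $\Lambda^k=\Lambda^{k-1}\cup h^k$; let $\mathbf{x}_{\Lambda^k}$ be the minimizer of $\|\mathbf{y}-\mathbf{\Phi}\mathbf{z}\|_2$ over $\mathbf{z}\in\mathbb{R}^n$ supported in $\Lambda^k$; put $\mathbf{r}^k=\mathbf{y}-\mathbf{\Phi}\mathbf{x}_{\Lambda^k}$. The output is the last least-squares estimate $\mathbf{x}_{\Lambda^k}$. It is assumed that the matrices $\mathbf{\Phi}_{\Lambda^k}$ have full column rank. Exact recovery means that the output equals $\mathbf{x}$. *)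

theory Defs
  imports "HOL-Analysis.Analysis"
begin

definition vec_support :: "real ^ 'n \<Rightarrow> 'n set" where
  "vec_support x = {j. x $ j \<noteq> 0}"

definition k_sparse :: "nat \<Rightarrow> real ^ 'n \<Rightarrow> bool" where
  "k_sparse K x \<longleftrightarrow> card (vec_support x) \<le> K"

text \<open>
  A vector \<open>q\<close> of \<open>\<real>\<^sup>I\<close> is represented by a function of which only the values on \<open>I\<close> are used;
  the product of the column submatrix \<open>\<Phi>\<^sub>I\<close> with \<open>q\<close> is then the combination of the columns
  indexed by \<open>I\<close> with coefficients \<open>q\<close>.
\<close>

definition rip_ineqs :: "real ^ 'n ^ 'm \<Rightarrow> nat \<Rightarrow> real \<Rightarrow> bool" where
  "rip_ineqs \<Phi> L \<delta> \<longleftrightarrow>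
     (\<forall>I q. card I \<le> L \<longrightarrow>
        (1 - \<delta>) * (\<Sum>j\<in>I. (q j)\<^sup>2) \<le> (norm (\<Sum>j\<in>I. q j *\<^sub>R column j \<Phi>))\<^sup>2 \<and>
        (norm (\<Sum>j\<in>I. q j *\<^sub>R column j \<Phi>))\<^sup>2 \<le> (1 + \<delta>) * (\<Sum>j\<in>I. (q j)\<^sup>2))"

definition rip :: "real ^ 'n ^ 'm \<Rightarrow> nat \<Rightarrow> bool" where
  "rip \<Phi> L \<longleftrightarrow> (\<exists>\<delta>. 0 < \<delta> \<and> \<delta> < 1 \<and> rip_ineqs \<Phi> L \<delta>)"

text \<open>For \<open>L \<ge> 1\<close> the infimum is attained, see \<open>rip_constant_least\<close> below.\<close>

definition rip_constant :: "real ^ 'n ^ 'm \<Rightarrow> nat \<Rightarrow> real" where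
  "rip_constant \<Phi> L = Inf {\<delta>. rip_ineqs \<Phi> L \<delta>}"

definition top_indices :: "real ^ 'n ^ 'm \<Rightarrow> real ^ 'm \<Rightarrow> nat \<Rightarrow> 'n set \<Rightarrow> bool" where
  "top_indices \<Phi> r N h \<longleftrightarrow>
     card h = N \<and> (\<forall>i\<in>h. \<forall>j. j \<notin> h \<longrightarrow> \<bar>r \<bullet> column j \<Phi>\<bar> \<le> \<bar>r \<bullet> column i \<Phi>\<bar>)"

definition least_squares :: "real ^ 'n ^ 'm \<Rightarrow> real ^ 'm \<Rightarrow> 'n set \<Rightarrow> real ^ 'n \<Rightarrow> bool" where
  "least_squares \<Phi> y S z \<longleftrightarrow>
     is_arg_min (\<lambda>w. norm (y - \<Phi> *v w)) (\<lambda>w. vec_support w \<subseteq> S) z"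

text \<open>
  Neither the selected indices (ties) nor, without full column rank, the least squares estimate
  are determined by the input, so the algorithm is described by its possible runs.
  A run consists of the index sets \<open>\<Lambda> k\<close>, the estimates \<open>z k\<close> and the residuals \<open>r k\<close>;
  the entry \<open>z 0\<close> has no meaning, and entries beyond the last iteration are arbitrary.
  Since \<open>card (\<Lambda> k) \<le> N * K\<close>, full column rank of the selected columns follows from the RIP
  of order \<open>N * K + 1\<close> and need not be imposed. For \<open>N \<le> n\<close> a run always exists
  (\<open>gomp_run_exists\<close>); for \<open>N > n\<close> there are no \<open>N\<close> indices to select.
\<close>

definition gomp_step ::
  "real ^ 'n ^ 'm \<Rightarrow> real ^ 'm \<Rightarrow> nat \<Rightarrow> 'n set \<Rightarrow> real ^ 'm
     \<Rightarrow> 'n set \<Rightarrow> real ^ 'n \<Rightarrow> real ^ 'm \<Rightarrow> bool" where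
  "gomp_step \<Phi> y N S r S' z' r' \<longleftrightarrow>
     (\<exists>h. top_indices \<Phi> r N h \<and> S' = S \<union> h) \<and> least_squares \<Phi> y S' z' \<and> r' = y - \<Phi> *v z'"

definition gomp_continue :: "nat \<Rightarrow> (nat \<Rightarrow> real ^ 'm) \<Rightarrow> nat \<Rightarrow> bool" where
  "gomp_continue K r k \<longleftrightarrow> k < K \<and> (k = 0 \<or> norm (r k) < norm (r (k - 1)))"

text \<open>\<open>gomp_run \<Phi> y K N \<Lambda> z r k\<close>: the algorithm stops after exactly \<open>k\<close> iterations, with output \<open>z k\<close>.\<close>

definition gomp_run ::
  "real ^ 'n ^ 'm \<Rightarrow> real ^ 'm \<Rightarrow> nat \<Rightarrow> nat
     \<Rightarrow> (nat \<Rightarrow> 'n set) \<Rightarrow> (nat \<Rightarrow> real ^ 'n) \<Rightarrow> (nat \<Rightarrow> real ^ 'm) \<Rightarrow> nat \<Rightarrow> bool" where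
  "gomp_run \<Phi> y K N \<Lambda> z r k \<longleftrightarrow>
     \<Lambda> 0 = {} \<and> r 0 = y \<and>
     (\<forall>i<k. gomp_continue K r i \<and>
        gomp_step \<Phi> y N (\<Lambda> i) (r i) (\<Lambda> (Suc i)) (z (Suc i)) (r (Suc i))) \<and>
     \<not> gomp_continue K r k"

lemma rip_constant_least:
  fixes \<Phi> :: "real ^ 'n ^ 'm"
  assumes "L \<ge> 1" and "rip \<Phi> L"
  shows "rip_ineqs \<Phi> L (rip_constant \<Phi> L)"
    and "rip_ineqs \<Phi> L \<delta> \<Longrightarrow> rip_constant \<Phi> L \<le> \<delta>"
proof -
  let ?D = "{\<delta>. rip_ineqs \<Phi> L \<delta>}"
  have ne: "?D \<noteq> {}"
    using assms(2) by (auto simp: rip_def)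
  have pos: "0 \<le> d" if "d \<in> ?D" for d
  proof -
    obtain j :: 'n where True by simp
    have "\<forall>I q. card I \<le> L \<longrightarrow>
        (1 - d) * (\<Sum>j\<in>I. (q j)\<^sup>2) \<le> (norm (\<Sum>j\<in>I. q j *\<^sub>R column j \<Phi>))\<^sup>2 \<and>
        (norm (\<Sum>j\<in>I. q j *\<^sub>R column j \<Phi>))\<^sup>2 \<le> (1 + d) * (\<Sum>j\<in>I. (q j)\<^sup>2)"
      using that by (simp add: rip_ineqs_def)
    from this[rule_format, of "{j}" "\<lambda>_. 1"] assms(1)
    have "1 - d \<le> (norm (column j \<Phi>))\<^sup>2 \<and> (norm (column j \<Phi>))\<^sup>2 \<le> 1 + d"
      by simp
    then show ?thesis by simp
  qed
  then have bdd: "bdd_below ?D" by (intro bdd_belowI) auto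
  show "rip_constant \<Phi> L \<le> \<delta>" if "rip_ineqs \<Phi> L \<delta>"
    unfolding rip_constant_def using that bdd by (intro cInf_lower) auto
  show "rip_ineqs \<Phi> L (rip_constant \<Phi> L)"
    unfolding rip_ineqs_def
  proof (intro allI impI)
    fix I :: "'n set" and q :: "'n \<Rightarrow> real"
    assume I: "card I \<le> L"
    let ?a = "\<Sum>j\<in>I. (q j)\<^sup>2" and ?b = "(norm (\<Sum>j\<in>I. q j *\<^sub>R column j \<Phi>))\<^sup>2"
    have D: "(1 - d) * ?a \<le> ?b \<and> ?b \<le> (1 + d) * ?a" if "d \<in> ?D" for d
      using that I by (auto simp: rip_ineqs_def)
    have a0: "0 \<le> ?a" by (simp add: sum_nonneg)
    show "(1 - rip_constant \<Phi> L) * ?a \<le> ?b \<and> ?b \<le> (1 + rip_constant \<Phi> L) * ?a"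
    proof (cases "?a = 0")
      case True
      obtain d where "d \<in> ?D" using ne by blast
      from D[OF this] True show ?thesis by (simp only: mult_zero_right)
    next
      case False
      then have a: "0 < ?a" using a0 by linarith
      have "(?a - ?b) / ?a \<le> d \<and> (?b - ?a) / ?a \<le> d" if "d \<in> ?D" for d
        using D[OF that] a by (simp add: pos_divide_le_eq algebra_simps)
      then have "(?a - ?b) / ?a \<le> rip_constant \<Phi> L" "(?b - ?a) / ?a \<le> rip_constant \<Phi> L"
        unfolding rip_constant_def by (blast intro: cInf_greatest[OF ne])+
      then show ?thesis using a by (simp add: pos_divide_le_eq algebra_simps)
    qed
  qed
qed

lemma top_indices_exists:
  fixes \<Phi> :: "real ^ 'n ^ 'm"
  assumes "N \<le> CARD('n)"
  shows "\<exists>h. top_indices \<Phi> r N h"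
  using assms
proof (induction N)
  case 0
  then show ?case by (auto simp: top_indices_def)
next
  case (Suc N)
  then obtain h where h: "top_indices \<Phi> r N h" by auto
  let ?f = "\<lambda>j. \<bar>r \<bullet> column j \<Phi>\<bar>"
  have "h \<noteq> UNIV"
    using h Suc.prems by (auto simp: top_indices_def)
  then have ne: "?f ` (- h) \<noteq> {}" by auto
  obtain i where i: "i \<notin> h" "?f i = Max (?f ` (- h))"
    using Max_in[OF _ ne] by fastforce
  have "?f j \<le> ?f i" if "j \<notin> h" for j
    using that unfolding i(2) by (intro Max_ge) auto
  then have "top_indices \<Phi> r (Suc N) (insert i h)"
    using h i(1) by (auto simp: top_indices_def)
  then show ?case ..
qed

lemma least_squares_exists:
  fixes \<Phi> :: "real ^ 'n ^ 'm"
  shows "\<exists>z. least_squares \<Phi> y S z"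
proof -
  let ?V = "{w :: real ^ 'n. vec_support w \<subseteq> S}"
  have V_eq: "?V = {w. \<forall>t. t \<notin> S \<longrightarrow> w $ t = 0}"
    by (auto simp: vec_support_def)
  have V: "subspace ?V"
    unfolding V_eq by (simp add: subspace_def)
  then have "subspace ((\<lambda>w. \<Phi> *v w) ` ?V)"
    by (intro linear_subspace_image matrix_vector_mul_linear)
  moreover have "0 \<in> ?V" by (simp add: vec_support_def)
  ultimately obtain p where p: "p \<in> (\<lambda>w. \<Phi> *v w) ` ?V"
      "\<And>u. u \<in> (\<lambda>w. \<Phi> *v w) ` ?V \<Longrightarrow> dist y p \<le> dist y u"
    using distance_attains_inf[OF closed_subspace, of "(\<lambda>w. \<Phi> *v w) ` ?V" y] by blast
  then obtain z where "z \<in> ?V" "p = \<Phi> *v z" by blast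
  with p(2) have "least_squares \<Phi> y S z"
    by (auto simp: least_squares_def is_arg_min_def dist_norm not_less)
  then show ?thesis ..
qed

lemma gomp_run_exists:
  fixes \<Phi> :: "real ^ 'n ^ 'm"
  assumes "N \<le> CARD('n)"
  shows "\<exists>\<Lambda> z r k. gomp_run \<Phi> y K N \<Lambda> z r k"
proof -
  let ?next = "\<lambda>s s'. gomp_step \<Phi> y N (fst s) (snd (snd s)) (fst s') (fst (snd s')) (snd (snd s'))"
  have ex: "\<exists>s'. ?next s s'" for s :: "'n set \<times> (real ^ 'n) \<times> (real ^ 'm)"
  proof -
    obtain h where "top_indices \<Phi> (snd (snd s)) N h"
      using top_indices_exists[OF assms] by blast
    moreover obtain z where "least_squares \<Phi> y (fst s \<union> h) z"
      using least_squares_exists by blast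
    ultimately have "?next s (fst s \<union> h, z, y - \<Phi> *v z)"
      by (auto simp: gomp_step_def)
    then show ?thesis by (rule exI)
  qed
  define f where "f = rec_nat ({}, 0, y) (\<lambda>_ s. SOME s'. ?next s s')"
  have f: "f 0 = ({}, 0, y)" "?next (f n) (f (Suc n))" for n
    unfolding f_def using someI_ex[OF ex] by simp_all
  define \<Lambda> z r where d: "\<Lambda> = fst \<circ> f" "z = fst \<circ> snd \<circ> f" "r = snd \<circ> snd \<circ> f"
  have step: "gomp_step \<Phi> y N (\<Lambda> i) (r i) (\<Lambda> (Suc i)) (z (Suc i)) (r (Suc i))" for i
    using f(2)[of i] by (simp add: d)
  let ?k = "LEAST k. \<not> gomp_continue K r k"
  have "\<not> gomp_continue K r K" by (simp add: gomp_continue_def)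
  then have "\<not> gomp_continue K r ?k" by (rule LeastI)
  moreover have "gomp_continue K r i" if "i < ?k" for i
    using not_less_Least[OF that] by simp
  moreover have "\<Lambda> 0 = {}" "r 0 = y" by (simp_all add: d f(1))
  ultimately have "gomp_run \<Phi> y K N \<Lambda> z r ?k"
    unfolding gomp_run_def using step by blast
  then show ?thesis by blast
qed

end

theory Submission
  imports Defs
begin

text \<open>
  Let \<open>T\<close> be the support of \<open>x\<close>, and suppose that the first \<open>k < K\<close> iterations have found at
  least \<open>k\<close> elements of \<open>T\<close>, but not all. The residual is \<open>\<Phi> u\<close>, where \<open>u = x - z\<close> is supported
  in \<open>\<Lambda> \<union> T\<close>, and it is orthogonal to the columns in \<open>\<Lambda>\<close>. Let \<open>h\<close> be the next selection and
  \<open>a\<close> the smallest correlation of the residual with a column in \<open>h\<close>. If \<open>h\<close> misses \<open>T - \<Lambda>\<close>, then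
  \<open>a\<close> bounds the correlations on \<open>T - \<Lambda>\<close>, so that
  \<open>(1 - \<delta>) \<parallel>u\<parallel>\<^sup>2 \<le> \<parallel>\<Phi> u\<parallel>\<^sup>2 \<le> a * sqrt K * \<parallel>u\<parallel>\<close>, while near-orthogonality of disjointly supported
  vectors gives \<open>sqrt N * a \<le> \<delta> \<parallel>u\<parallel>\<close>. Together these contradict the bound on \<open>\<delta>\<close>. The set
  \<open>\<Lambda> \<union> T \<union> h\<close> involved has at most \<open>N k + (K - k) + N \<le> N K + 1\<close> elements. Hence every iteration
  finds a new element of \<open>T\<close>.
\<close>

section \<open>The restricted isometry property in terms of sparse vectors\<close>

lemma inner_matrix_vector_mult_columns:
  fixes A :: "real ^ 'n ^ 'm"
  shows "v \<bullet> (A *v u) = (\<Sum>j\<in>UNIV. u $ j * (v \<bullet> column j A))"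
  by (simp add: matrix_mult_sum inner_sum_right scalar_mult_eq_scaleR)

lemma norm_power2_eq_sum_support:
  fixes u :: "real ^ 'n"
  assumes "vec_support u \<subseteq> I"
  shows "(norm u)\<^sup>2 = (\<Sum>j\<in>I. (u $ j)\<^sup>2)"
proof -
  have "(norm u)\<^sup>2 = (\<Sum>j\<in>UNIV. (u $ j)\<^sup>2)"
    unfolding power2_norm_eq_inner inner_vec_def by (simp add: power2_eq_square)
  also have "\<dots> = (\<Sum>j\<in>I. (u $ j)\<^sup>2)"
    using assms by (intro sum.mono_neutral_right) (auto simp: vec_support_def)
  finally show ?thesis .
qed

lemma matrix_vector_mult_eq_sum_support:
  fixes A :: "real ^ 'n ^ 'm"
  assumes "vec_support u \<subseteq> I"
  shows "A *v u = (\<Sum>j\<in>I. u $ j *\<^sub>R column j A)"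
proof -
  have "A *v u = (\<Sum>j\<in>UNIV. u $ j *\<^sub>R column j A)"
    by (simp add: matrix_mult_sum scalar_mult_eq_scaleR)
  also have "\<dots> = (\<Sum>j\<in>I. u $ j *\<^sub>R column j A)"
    using assms by (intro sum.mono_neutral_right) (auto simp: vec_support_def)
  finally show ?thesis .
qed

lemma rip_ineqs_vec:
  assumes "rip_ineqs \<Phi> L \<delta>" "card (vec_support u) \<le> L"
  shows "(1 - \<delta>) * (norm u)\<^sup>2 \<le> (norm (\<Phi> *v u))\<^sup>2"
    and "(norm (\<Phi> *v u))\<^sup>2 \<le> (1 + \<delta>) * (norm u)\<^sup>2"
  using assms
  unfolding rip_ineqs_def norm_power2_eq_sum_support[OF order_refl]
    matrix_vector_mult_eq_sum_support[OF order_refl]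
  by blast+

text \<open>This injectivity on sparse vectors takes the place of full column rank of the selected
  columns.\<close>

lemma rip_ineqs_kernel:
  assumes "rip_ineqs \<Phi> L \<delta>" "\<delta> < 1" "card (vec_support u) \<le> L" "\<Phi> *v u = 0"
  shows "u = 0"
proof (rule ccontr)
  assume "u \<noteq> 0"
  then have "0 < (1 - \<delta>) * (norm u)\<^sup>2" using assms(2) by simp
  then show False using rip_ineqs_vec(1)[OF assms(1,3)] assms(4) by simp
qed

text \<open>\<open>rip_ineqs\<close> has no sign condition on \<delta>, but the two bounds for a
  single nonzero vector force one.\<close>

lemma rip_ineqs_nonneg:
  fixes \<Phi> :: "real ^ 'n ^ 'm" and u :: "real ^ 'n"
  assumes "rip_ineqs \<Phi> L \<delta>" "card (vec_support u) \<le> L" "u \<noteq> 0"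
  shows "0 \<le> \<delta>"
proof -
  have "(1 - \<delta>) * (norm u)\<^sup>2 \<le> (1 + \<delta>) * (norm u)\<^sup>2"
    using rip_ineqs_vec[OF assms(1,2)] by linarith
  then show ?thesis using assms(3) by (simp add: mult_le_cancel_right)
qed

lemma rip_ineqs_near_orthogonal:
  fixes \<Phi> :: "real ^ 'n ^ 'm"
  assumes rip: "rip_ineqs \<Phi> L \<delta>"
    and card: "card (vec_support u \<union> vec_support v) \<le> L"
    and disj: "vec_support u \<inter> vec_support v = {}"
  shows "(\<Phi> *v u) \<bullet> (\<Phi> *v v) \<le> \<delta> * norm u * norm v"
proof (cases "u = 0 \<or> v = 0")
  case True
  then show ?thesis by auto
next
  case False
  define a b where ab: "a = norm u" "b = norm v"
  have pos: "0 < a" "0 < b" using False by (auto simp: ab)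
  \<comment> \<open>polarization, after scaling both vectors to the same norm\<close>
  define p q where pq: "p = b *\<^sub>R u" "q = a *\<^sub>R v"
  have "u \<bullet> v = 0"
    unfolding inner_vec_def using disj by (auto simp: vec_support_def intro!: sum.neutral)
  then have orth: "p \<bullet> q = 0" by (simp add: pq)
  have "(norm p)\<^sup>2 = (a * b)\<^sup>2" "(norm q)\<^sup>2 = (a * b)\<^sup>2"
    by (simp_all add: pq ab power_mult_distrib)
  then have n: "(norm (p + q))\<^sup>2 = 2 * (a * b)\<^sup>2" "(norm (p - q))\<^sup>2 = 2 * (a * b)\<^sup>2"
    using orth by (simp_all add: power2_norm_eq_inner algebra_simps inner_commute)
  have "card (vec_support (p + q)) \<le> card (vec_support u \<union> vec_support v)"
    "card (vec_support (p - q)) \<le> card (vec_support u \<union> vec_support v)"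
    by (auto simp: vec_support_def pq intro!: card_mono)
  then have c: "card (vec_support (p + q)) \<le> L" "card (vec_support (p - q)) \<le> L"
    using card by linarith+
  have "4 * ((\<Phi> *v p) \<bullet> (\<Phi> *v q)) = (norm (\<Phi> *v (p + q)))\<^sup>2 - (norm (\<Phi> *v (p - q)))\<^sup>2"
    by (simp add: power2_norm_eq_inner matrix_vector_right_distrib
        matrix_vector_mult_diff_distrib algebra_simps inner_commute)
  also have "\<dots> \<le> (1 + \<delta>) * (2 * (a * b)\<^sup>2) - (1 - \<delta>) * (2 * (a * b)\<^sup>2)"
    using rip_ineqs_vec(2)[OF rip c(1)] rip_ineqs_vec(1)[OF rip c(2)] n by simp
  also have "\<dots> = 4 * (\<delta> * (a * b)\<^sup>2)" by (simp add: algebra_simps)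
  finally have "(a * b) * ((\<Phi> *v u) \<bullet> (\<Phi> *v v)) \<le> (a * b) * (\<delta> * a * b)"
    by (simp add: pq matrix_vector_mult_scaleR power2_eq_square algebra_simps)
  then show ?thesis
    using pos by (simp add: ab mult_le_cancel_left_pos)
qed

section \<open>Least squares and vanishing correlations\<close>

text \<open>Changing the \<open>j\<close>-th entry of \<open>z\<close> keeps it feasible. The best
  change \<open>t\<close> subtracts from the residual its projection onto the column, which would
  shorten it unless that projection is zero.\<close>

lemma least_squares_orthogonal:
  fixes \<Phi> :: "real ^ 'n ^ 'm"
  assumes ls: "least_squares \<Phi> y S z" and j: "j \<in> S"
  shows "(y - \<Phi> *v z) \<bullet> column j \<Phi> = 0"
proof (cases "column j \<Phi> = 0")
  case False
  define r c t where "r = y - \<Phi> *v z" and "c = column j \<Phi>" and "t = (r \<bullet> c) / (c \<bullet> c)"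
  have c: "0 < c \<bullet> c" using False by (simp add: c_def)
  let ?w = "z + t *\<^sub>R axis j 1"
  have "vec_support z \<subseteq> S" using ls by (simp add: least_squares_def is_arg_min_def)
  then have "vec_support ?w \<subseteq> S"
    using j by (auto simp: vec_support_def axis_def)
  then have "norm r \<le> norm (y - \<Phi> *v ?w)"
    using ls by (auto simp: least_squares_def is_arg_min_def r_def not_less)
  also have "y - \<Phi> *v ?w = r - t *\<^sub>R c"
    by (simp add: r_def c_def matrix_vector_right_distrib matrix_vector_mult_scaleR
        matrix_vector_mult_basis)
  finally have "(norm r)\<^sup>2 \<le> (norm (r - t *\<^sub>R c))\<^sup>2" by (simp add: power_mono)
  also have "\<dots> = (norm r)\<^sup>2 - 2 * t * (r \<bullet> c) + t * t * (c \<bullet> c)"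
    by (simp add: power2_norm_eq_inner algebra_simps inner_commute)
  also have "\<dots> = (norm r)\<^sup>2 - (r \<bullet> c)\<^sup>2 / (c \<bullet> c)"
    using c by (simp add: t_def power2_eq_square)
  finally have "(r \<bullet> c)\<^sup>2 / (c \<bullet> c) \<le> 0" by simp
  then have "(r \<bullet> c)\<^sup>2 \<le> 0" using c by (simp add: divide_le_0_iff)
  then show ?thesis by (simp add: r_def c_def)
qed simp

text \<open>Expanding one factor of \<open>(A *v u) \<bullet> (A *v u)\<close> into columns leaves
  only terms from the support of \<open>u\<close>.\<close>

lemma matrix_vector_mult_eq_0_if_orthogonal:
  fixes A :: "real ^ 'n ^ 'm"
  assumes "\<And>j. j \<in> vec_support u \<Longrightarrow> (A *v u) \<bullet> column j A = 0"
  shows "A *v u = 0"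
proof -
  have "(A *v u) \<bullet> (A *v u) = 0"
    unfolding inner_matrix_vector_mult_columns[of "A *v u" A u]
    using assms by (intro sum.neutral) (auto simp: vec_support_def)
  then show ?thesis by simp
qed

text \<open>No unselected correlation exceeds a selected one, so a single selected zero makes all
  unselected ones zero.\<close>

lemma top_indices_orthogonal:
  assumes "top_indices \<Phi> r N h" "i \<in> h" "r \<bullet> column i \<Phi> = 0" "j \<notin> h"
  shows "r \<bullet> column j \<Phi> = 0"
  using assms unfolding top_indices_def by fastforce

section \<open>Each selection meets the missing part of the support\<close>

text \<open>Only the sizes of the index sets matter here, so the iteration count does not appear;
  \<open>gomp_step_progress\<close> supplies the sizes.\<close>

lemma top_indices_hit:
  fixes \<Phi> :: "real ^ 'n ^ 'm"
  assumes rip: "rip_ineqs \<Phi> L \<delta>"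
    and \<delta>: "\<delta> * (sqrt K + sqrt N) < sqrt N"
    and N: "N \<ge> 1"
    and top: "top_indices \<Phi> (\<Phi> *v u) N h"
    and u: "u \<noteq> 0" "vec_support u \<subseteq> S \<union> T"
    and orth: "\<And>j. j \<in> S \<Longrightarrow> (\<Phi> *v u) \<bullet> column j \<Phi> = 0"
    and cards: "card (S \<union> T \<union> h) \<le> L" "card (T - S) \<le> K"
  shows "h \<inter> (T - S) \<noteq> {}"
proof
  assume miss: "h \<inter> (T - S) = {}"
  define r where "r = \<Phi> *v u"
  have fin: "finite h" "h \<noteq> {}" "card h = N"
    using top N by (auto simp: top_indices_def)
  have cu: "card (vec_support u) \<le> L"
    using u(2) cards(1) card_mono[of "S \<union> T \<union> h" "vec_support u"] by fastforce
  have \<delta>0: "0 \<le> \<delta>" using rip_ineqs_nonneg[OF rip cu u(1)] .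
  have \<delta>1: "\<delta> < 1"
  proof (rule ccontr)
    assume "\<not> \<delta> < 1"
    then have "1 * sqrt N \<le> \<delta> * (sqrt K + sqrt N)" by (intro mult_mono) auto
    with \<delta> show False by simp
  qed
  \<comment> \<open>Reselecting an index of \<open>S\<close>, where correlations vanish, would make
    those on the unselected set \<open>T - S\<close> vanish too, hence
    \<open>\<Phi> *v u = 0\<close>. Disjointness is needed for near-orthogonality below.\<close>
  have disj: "h \<inter> S = {}"
  proof (rule ccontr)
    assume "h \<inter> S \<noteq> {}"
    then obtain i where i: "i \<in> h" "i \<in> S" by blast
    have "(\<Phi> *v u) \<bullet> column j \<Phi> = 0" if "j \<in> vec_support u" for j
      using that u(2) miss orth top_indices_orthogonal[OF top i(1) orth[OF i(2)]] by blast
    from rip_ineqs_kernel[OF rip \<delta>1 cu matrix_vector_mult_eq_0_if_orthogonal[OF this]]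
    show False using u(1) by simp
  qed
  define a where "a = Min ((\<lambda>i. \<bar>r \<bullet> column i \<Phi>\<bar>) ` h)"
  have a_le: "a \<le> \<bar>r \<bullet> column i \<Phi>\<bar>" if "i \<in> h" for i
    unfolding a_def using that by (intro Min_le) auto
  have le_a: "\<bar>r \<bullet> column j \<Phi>\<bar> \<le> a" if "j \<in> T - S" for j
    unfolding a_def using that fin miss top by (auto simp: top_indices_def r_def)
  have a0: "0 \<le> a" unfolding a_def using fin by simp

  \<comment> \<open>Cauchy-Schwarz: passing from the 1-norm on \<open>T - S\<close> to the 2-norm
    costs the factor \<open>sqrt K\<close>.\<close>
  have "(\<Sum>j\<in>T - S. \<bar>u $ j\<bar>)\<^sup>2 \<le> (\<Sum>j\<in>T - S. \<bar>u $ j\<bar>\<^sup>2) * card (T - S)"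
    by (rule sum_squared_le_sum_of_squares)
  also have "\<dots> \<le> (norm u)\<^sup>2 * K"
    unfolding norm_power2_eq_sum_support[OF subset_UNIV] using cards(2)
    by (intro mult_mono) (auto intro: sum_mono2 sum_nonneg)
  also have "\<dots> = (sqrt K * norm u)\<^sup>2" by (simp add: power_mult_distrib)
  finally have l1: "(\<Sum>j\<in>T - S. \<bar>u $ j\<bar>) \<le> sqrt K * norm u"
    by (rule power2_le_imp_le) simp
  have "(norm r)\<^sup>2 = r \<bullet> (\<Phi> *v u)" by (simp add: r_def power2_norm_eq_inner)
  also have "\<dots> = (\<Sum>j\<in>T - S. u $ j * (r \<bullet> column j \<Phi>))"
    unfolding inner_matrix_vector_mult_columns using u(2) orth
    by (intro sum.mono_neutral_right) (auto simp: vec_support_def r_def)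
  also have "\<dots> \<le> (\<Sum>j\<in>T - S. \<bar>u $ j\<bar> * a)"
  proof (rule sum_mono)
    fix j assume "j \<in> T - S"
    have "u $ j * (r \<bullet> column j \<Phi>) \<le> \<bar>u $ j\<bar> * \<bar>r \<bullet> column j \<Phi>\<bar>"
      by (simp flip: abs_mult)
    also have "\<dots> \<le> \<bar>u $ j\<bar> * a" using le_a[OF \<open>j \<in> T - S\<close>] by (intro mult_left_mono) auto
    finally show "u $ j * (r \<bullet> column j \<Phi>) \<le> \<bar>u $ j\<bar> * a" .
  qed
  also have "\<dots> \<le> sqrt K * norm u * a"
    unfolding sum_distrib_right[symmetric] using l1 a0 by (intro mult_right_mono)
  finally have upper: "(1 - \<delta>) * (norm u)\<^sup>2 \<le> sqrt K * norm u * a"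
    using rip_ineqs_vec(1)[OF rip cu] by (simp add: r_def)

  \<comment> \<open>Pairing the residual with \<open>\<Phi> *v v\<close> sums the absolute
    correlations over \<open>h\<close>. Since \<open>sgn 0 = 0\<close>, the norm of \<open>v\<close>
    is only bounded by \<open>sqrt N\<close>.\<close>
  define v :: "real ^ 'n" where "v = (\<chi> i. if i \<in> h then sgn (r \<bullet> column i \<Phi>) else 0)"
  have sv: "vec_support v \<subseteq> h" by (auto simp: vec_support_def v_def)
  have "(norm v)\<^sup>2 = (\<Sum>i\<in>h. (sgn (r \<bullet> column i \<Phi>))\<^sup>2)"
    unfolding norm_power2_eq_sum_support[OF sv] by (intro sum.cong) (auto simp: v_def)
  also have "\<dots> \<le> (\<Sum>i\<in>h. 1)" by (intro sum_mono) (auto simp: sgn_if)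
  also have "\<dots> = (sqrt N)\<^sup>2" using fin(3) by simp
  finally have nv: "norm v \<le> sqrt N" by (rule power2_le_imp_le) simp
  have "vec_support u \<union> vec_support v \<subseteq> S \<union> T \<union> h" using u(2) sv by blast
  then have cuv: "card (vec_support u \<union> vec_support v) \<le> L"
    using cards(1) card_mono[of "S \<union> T \<union> h" "vec_support u \<union> vec_support v"] by fastforce
  have duv: "vec_support u \<inter> vec_support v = {}"
    using u(2) sv miss disj by blast
  have "N * a = (\<Sum>i\<in>h. a)" using fin(3) by simp
  also have "\<dots> \<le> (\<Sum>i\<in>h. \<bar>r \<bullet> column i \<Phi>\<bar>)" using a_le by (rule sum_mono)
  also have "\<dots> = (\<Sum>i\<in>UNIV. v $ i * (r \<bullet> column i \<Phi>))"
    by (rule sum.mono_neutral_cong_left) (auto simp: v_def abs_sgn)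
  also have "\<dots> = r \<bullet> (\<Phi> *v v)" by (rule inner_matrix_vector_mult_columns[symmetric])
  also have "\<dots> \<le> \<delta> * norm u * norm v"
    unfolding r_def by (rule rip_ineqs_near_orthogonal[OF rip cuv duv])
  also have "\<dots> \<le> \<delta> * norm u * sqrt N" using nv \<delta>0 by (intro mult_left_mono) auto
  finally have "sqrt N * (sqrt N * a) \<le> sqrt N * (\<delta> * norm u)"
    by (simp add: mult.left_commute[of \<delta>] mult.commute[of "sqrt N" "\<delta> * norm u"]
        flip: mult.assoc[of "sqrt N" "sqrt N" a])
  then have lower: "sqrt N * a \<le> \<delta> * norm u"
    using N by (simp add: mult_le_cancel_left_pos)

  \<comment> \<open>Eliminating \<open>a\<close> and cancelling the squared norm of \<open>u\<close>
    leaves \<open>(1 - \<delta>) * sqrt N \<le> sqrt K * \<delta>\<close>, exactly the negation of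
    the assumed threshold.\<close>
  have "(1 - \<delta>) * (norm u)\<^sup>2 * sqrt N \<le> sqrt K * norm u * a * sqrt N"
    using upper by (intro mult_right_mono) auto
  also have "\<dots> = sqrt K * norm u * (sqrt N * a)" by (simp add: mult_ac)
  also have "\<dots> \<le> sqrt K * norm u * (\<delta> * norm u)" using lower by (intro mult_left_mono) auto
  finally have "(norm u)\<^sup>2 * ((1 - \<delta>) * sqrt N) \<le> (norm u)\<^sup>2 * (sqrt K * \<delta>)"
    by (simp add: power2_eq_square mult_ac)
  then have "(1 - \<delta>) * sqrt N \<le> sqrt K * \<delta>"
    using u(1) by (simp add: mult_le_cancel_left_pos)
  then show False using \<delta> by (simp add: algebra_simps)
qed

section \<open>Progress in one iteration\<close>

text \<open>The strict decrease keeps the stopping test from ending the run before the support is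
  found.\<close>

lemma gomp_step_progress:
  fixes \<Phi> :: "real ^ 'n ^ 'm"
  assumes rip: "rip_ineqs \<Phi> (N * K + 1) \<delta>"
    and \<delta>: "\<delta> * (sqrt K + sqrt N) < sqrt N" "\<delta> < 1"
    and N: "N \<ge> 1" and k: "k < K"
    and sparse: "k_sparse K x"
    and ls: "least_squares \<Phi> (\<Phi> *v x) S z"
    and S: "card S \<le> N * k" "k \<le> card (vec_support x \<inter> S)" "\<not> vec_support x \<subseteq> S"
    and step: "gomp_step \<Phi> (\<Phi> *v x) N S (\<Phi> *v x - \<Phi> *v z) S' z' r'"
  shows "Suc k \<le> card (vec_support x \<inter> S')"
    and "norm r' < norm (\<Phi> *v x - \<Phi> *v z)"
proof -
  let ?T = "vec_support x"
  define u where "u = x - z"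
  have r: "\<Phi> *v x - \<Phi> *v z = \<Phi> *v u"
    by (simp add: u_def matrix_vector_mult_diff_distrib)
  obtain h where h: "top_indices \<Phi> (\<Phi> *v u) N h" "S' = S \<union> h"
    and ls': "least_squares \<Phi> (\<Phi> *v x) S' z'" and r': "r' = \<Phi> *v x - \<Phi> *v z'"
    using step by (auto simp: gomp_step_def r)
  have ch: "card h = N" using h(1) by (simp add: top_indices_def)
  have z: "vec_support z \<subseteq> S" using ls by (simp add: least_squares_def is_arg_min_def)
  then have su: "vec_support u \<subseteq> S \<union> ?T" by (auto simp: vec_support_def u_def)
  have u0: "u \<noteq> 0" using z S(3) by (auto simp: u_def)
  have orth: "(\<Phi> *v u) \<bullet> column j \<Phi> = 0" if "j \<in> S" for j
    using least_squares_orthogonal[OF ls that] by (simp add: r)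
  have "card ?T = card (?T - S) + card (?T \<inter> S)"
    using card_Int_Diff[of ?T S] by simp
  then have cT: "card (?T - S) + k \<le> K"
    using sparse S(2) by (simp add: k_sparse_def)
  \<comment> \<open>Support elements already found are counted in \<open>card S\<close>
    only.\<close>
  have "card (S \<union> ?T \<union> h) = card (S \<union> (?T - S) \<union> h)" by simp
  also have "\<dots> \<le> card S + card (?T - S) + card h"
    by (meson add_le_mono card_Un_le order_refl order_trans)
  also have "\<dots> \<le> N * k + (K - k) + N" using S(1) cT ch by linarith
  \<comment> \<open>For \<open>K = Suc (k + d)\<close> and \<open>N = Suc M\<close> the sides differ
    by \<open>M * d\<close>; the bound is attained when \<open>k = K - 1\<close> or
    \<open>N = 1\<close>.\<close>
  also have "\<dots> \<le> N * K + 1"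
  proof -
    obtain d where d: "K = Suc (k + d)" using k less_iff_Suc_add by auto
    obtain M where M: "N = Suc M" using N by (cases N) auto
    show ?thesis by (simp add: d M algebra_simps)
  qed
  finally have cards: "card (S \<union> ?T \<union> h) \<le> N * K + 1" .
  have "card (?T - S) \<le> K" using cT by simp
  from top_indices_hit[OF rip \<delta>(1) N h(1) u0 su orth cards this]
  obtain j where j: "j \<in> h" "j \<in> ?T" "j \<notin> S" by blast
  have "Suc k \<le> Suc (card (?T \<inter> S))" using S(2) by simp
  also have "\<dots> = card (insert j (?T \<inter> S))" using j by simp
  also have "\<dots> \<le> card (?T \<inter> S')" using j h(2) by (intro card_mono) auto
  finally show "Suc k \<le> card (?T \<inter> S')" .
  \<comment> \<open>Without decrease the old \<open>z\<close> still minimizes over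
    \<open>S'\<close>, so the residual is orthogonal to the newly selected column \<open>j\<close>.
    Then every correlation vanishes, forcing \<open>u = 0\<close>.\<close>
  show "norm r' < norm (\<Phi> *v x - \<Phi> *v z)"
  proof (rule ccontr)
    assume "\<not> ?thesis"
    then have "least_squares \<Phi> (\<Phi> *v x) S' z"
      using ls' z h(2) by (fastforce simp: least_squares_def is_arg_min_def r')
    from least_squares_orthogonal[OF this]
    have orth': "(\<Phi> *v u) \<bullet> column i \<Phi> = 0" if "i \<in> S'" for i using that by (simp add: r)
    have "(\<Phi> *v u) \<bullet> column i \<Phi> = 0" for i
      using orth' h(2) j(1) top_indices_orthogonal[OF h(1) j(1)] by blast
    then have "\<Phi> *v u = 0" by (rule matrix_vector_mult_eq_0_if_orthogonal)
    moreover have "card (vec_support u) \<le> N * K + 1"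
      using su cards card_mono[of "S \<union> ?T \<union> h" "vec_support u"] by fastforce
    ultimately show False using rip_ineqs_kernel[OF rip \<delta>(2)] u0 by blast
  qed
qed

section \<open>Exact recovery along a run\<close>

text \<open>As \<open>x\<close> is feasible with zero residual, \<open>z\<close> has zero residual
  as well, and \<Phi> is injective on vectors supported in \<open>S\<close>.\<close>

lemma least_squares_exact:
  fixes \<Phi> :: "real ^ 'n ^ 'm"
  assumes rip: "rip_ineqs \<Phi> L \<delta>" "\<delta> < 1"
    and S: "card S \<le> L" "vec_support x \<subseteq> S"
    and ls: "least_squares \<Phi> (\<Phi> *v x) S z"
  shows "z = x"
proof -
  have z: "vec_support z \<subseteq> S" using ls by (simp add: least_squares_def is_arg_min_def)
  have "norm (\<Phi> *v x - \<Phi> *v z) \<le> norm (\<Phi> *v x - \<Phi> *v x)"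
    using ls S(2) by (force simp: least_squares_def is_arg_min_def)
  then have "\<Phi> *v (x - z) = 0" by (simp add: matrix_vector_mult_diff_distrib)
  moreover have "vec_support (x - z) \<subseteq> S"
    using z S(2) by (force simp: vec_support_def)
  then have "card (vec_support (x - z)) \<le> L"
    using S(1) card_mono[of S "vec_support (x - z)"] by fastforce
  ultimately have "x - z = 0" using rip_ineqs_kernel[OF rip] by blast
  then show ?thesis by simp
qed

theorem theorem2:
  fixes \<Phi> :: "real ^ 'n ^ 'm" and x :: "real ^ 'n" and y :: "real ^ 'm" and K N :: nat
  assumes "K \<ge> 1" and "N \<ge> 1" and "N * K < CARD('m)"
    and "k_sparse K x"
    and "y = \<Phi> *v x"
    and "rip \<Phi> (N * K + 1)"
    and "rip_constant \<Phi> (N * K + 1) < sqrt (real N) / (sqrt (real K) + sqrt (real N))"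
  shows "\<forall>\<Lambda> z r k. gomp_run \<Phi> y K N \<Lambda> z r k \<longrightarrow> k \<le> K \<and> z k = x"
proof (intro allI impI)
  fix \<Lambda> z r k
  assume run: "gomp_run \<Phi> y K N \<Lambda> z r k"
  let ?T = "vec_support x"
  define \<delta> where "\<delta> = rip_constant \<Phi> (N * K + 1)"
  have rip: "rip_ineqs \<Phi> (N * K + 1) \<delta>"
    unfolding \<delta>_def using assms(6) by (intro rip_constant_least) auto
  have pos: "0 < sqrt (real K)" "0 < sqrt (real N)" using assms(1,2) by auto
  then have \<delta>: "\<delta> * (sqrt K + sqrt N) < sqrt N"
    using assms(7) by (simp add: \<delta>_def pos_less_divide_eq[OF add_pos_pos])
  have "sqrt (real N) / (sqrt (real K) + sqrt (real N)) < 1"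
    using pos by (simp add: pos_divide_less_eq[OF add_pos_pos])
  then have \<delta>1: "\<delta> < 1" using assms(7) by (simp add: \<delta>_def)

  have init: "\<Lambda> 0 = {}" "r 0 = y" and stop: "\<not> gomp_continue K r k"
    and cont: "\<And>i. i < k \<Longrightarrow> gomp_continue K r i"
    and step: "\<And>i. i < k \<Longrightarrow> gomp_step \<Phi> y N (\<Lambda> i) (r i) (\<Lambda> (Suc i)) (z (Suc i)) (r (Suc i))"
    using run by (auto simp: gomp_run_def)
  \<comment> \<open>At least one iteration takes place, so the output is never the meaningless
    \<open>z 0\<close>.\<close>
  have "gomp_continue K r 0" using assms(1) by (simp add: gomp_continue_def)
  then have k0: "k \<noteq> 0" using stop by metis
  have lt: "i < K" if "i < k" for i using cont[OF that] by (simp add: gomp_continue_def)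
  have kK: "k \<le> K" using lt[of "k - 1"] k0 by linarith

  \<comment> \<open>\<open>z 0\<close> is meaningless; the estimate belonging to \<open>r 0\<close> is the zero vector.\<close>
  define w where "w i = (if i = 0 then 0 else z i)" for i
  have ls: "least_squares \<Phi> y (\<Lambda> i) (w i) \<and> r i = y - \<Phi> *v w i" if "i \<le> k" for i
  proof (cases i)
    case 0
    have "vec_support v = {} \<longleftrightarrow> v = 0" for v :: "real ^ 'n"
      by (simp add: vec_support_def vec_eq_iff)
    then show ?thesis
      using 0 init by (auto simp: w_def least_squares_def is_arg_min_def)
  next
    case (Suc j)
    then show ?thesis using step[of j] that by (simp add: w_def gomp_step_def)
  qed
  have card_\<Lambda>: "card (\<Lambda> i) \<le> N * i" if "i \<le> k" for i
    using that
  proof (induction i)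
    case (Suc i)
    then obtain h where "card h = N" "\<Lambda> (Suc i) = \<Lambda> i \<union> h"
      using step[of i] by (auto simp: gomp_step_def top_indices_def)
    then show ?case using card_Un_le[of "\<Lambda> i" h] Suc by simp
  qed (simp add: init)
  have progress: "Suc i \<le> card (?T \<inter> \<Lambda> (Suc i))" "norm (r (Suc i)) < norm (r i)"
    if i: "i < k" and "i \<le> card (?T \<inter> \<Lambda> i)" "\<not> ?T \<subseteq> \<Lambda> i" for i
    using gomp_step_progress[OF rip \<delta> \<delta>1 assms(2) lt[OF i] assms(4), of "\<Lambda> i" "w i"]
      that ls[of i] card_\<Lambda>[of i] step[OF i] by (auto simp: assms(5))
  have mono: "\<Lambda> i \<subseteq> \<Lambda> (Suc i)" if "i < k" for i
    using step[OF that] by (auto simp: gomp_step_def)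
  \<comment> \<open>The count is claimed only until the support is complete; afterwards there is
    nothing new to find.\<close>
  have inv: "?T \<subseteq> \<Lambda> i \<or> i \<le> card (?T \<inter> \<Lambda> i)" if "i \<le> k" for i
    using that
  proof (induction i)
    case (Suc i)
    then show ?case using progress(1)[of i] mono[of i] by auto
  qed simp
  \<comment> \<open>With support elements missing, the last iteration strictly decreased the
    residual, so only \<open>k = K\<close> can have stopped the run. But then \<open>K\<close>
    elements of \<open>?T\<close> have been found, which is all of them.\<close>
  have "?T \<subseteq> \<Lambda> k"
  proof (rule ccontr)
    assume out: "\<not> ?T \<subseteq> \<Lambda> k"
    obtain i where i: "k = Suc i" using k0 by (cases k) auto
    have "\<not> ?T \<subseteq> \<Lambda> i" using out mono[of i] i by auto
    then have "norm (r k) < norm (r (k - 1))"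
      using progress(2)[of i] inv[of i] i by auto
    then have "k = K" using stop kK by (auto simp: gomp_continue_def)
    then have "card ?T \<le> card (?T \<inter> \<Lambda> k)"
      using inv[of k] out assms(4) by (auto simp: k_sparse_def)
    then have "?T \<inter> \<Lambda> k = ?T" by (intro card_seteq) auto
    then show False using out by blast
  qed
  moreover have "card (\<Lambda> k) \<le> N * K + 1"
    using card_\<Lambda>[of k] mult_le_mono2[OF kK, of N] by linarith
  ultimately have "w k = x"
    using least_squares_exact[OF rip \<delta>1, of "\<Lambda> k" x "w k"] ls[of k] by (simp add: assms(5))
  then show "k \<le> K \<and> z k = x" using kK k0 by (simp add: w_def)
qed

end
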